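(* A graph $G$ is leveled planar if and only if $G$ is bipartite and has a $3$-track layout.
   Context: Graphs are finite, simple and undirected. A leveled planar drawing of a graph is a straight-line crossing-free drawing in the plane such that the vertices are placed on a sequence of parallel lines (levels, numbered consecutively), where each edge joins vertices in two consecutive levels. A graph is leveled planar if it has a leveled planar drawing. A $k$-track layout of a graph is a partition of its vertex set into $k$ sequences, called tracks (some possibly empty), such that the vertices in each track form an independent set and the edges between each pair of tracks form a non-crossing set; that is, there are no edges $uv$ and $u'v'$ such that $u$ is before $u'$ in one track but $v$ is after $v'$ in another track. *)

theory Defs
  imports "HOL-Analysis.Analysis" "Graph_Theory.Pair_Digraph"
begin

text \<open>
  A finite simple undirected graph is a \<open>pair_graph\<close>: a finite loop-free digraph with a symmetric
  arc set, so that the undirected edge \<open>uv\<close> is represented by the two arcs \<open>(u, v)\<close> and \<open>(v, u)\<close>.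
  Quantifying over arcs therefore means quantifying over edges in both orientations.
\<close>

definition bipartite :: "'a pair_pre_digraph \<Rightarrow> bool" where
  "bipartite G \<longleftrightarrow>
     (\<exists>A B. A \<union> B = pverts G \<and> A \<inter> B = {} \<and>
       (\<forall>(u, v) \<in> parcs G. (u \<in> A \<and> v \<in> B) \<or> (u \<in> B \<and> v \<in> A)))"

text \<open>
  A straight-line drawing is determined by the positions of the vertices. In a crossing-free one,
  edges meet only in the images of common endpoints. The second condition also covers isolated
  vertices, which must not lie on any edge.
\<close>

definition crossing_free_drawing :: "'a pair_pre_digraph \<Rightarrow> ('a \<Rightarrow> real \<times> real) \<Rightarrow> bool" where
  "crossing_free_drawing G p \<longleftrightarrow>
     inj_on p (pverts G) \<and>
     (\<forall>(u, v) \<in> parcs G. \<forall>w \<in> pverts G - {u, v}. p w \<notin> closed_segment (p u) (p v)) \<and>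
     (\<forall>(u, v) \<in> parcs G. \<forall>(x, y) \<in> parcs G. {u, v} \<noteq> {x, y} \<longrightarrow>
        closed_segment (p u) (p v) \<inter> closed_segment (p x) (p y) \<subseteq> p ` ({u, v} \<inter> {x, y}))"

text \<open>
  The levels are the parallel lines with common normal vector \<open>n\<close>; the strictly increasing offsets
  \<open>c\<close> number them in their geometric order. The vertex \<open>v\<close> is placed on level \<open>l v\<close>. Levels may
  be empty; as the graph is finite, only finitely many are used.
\<close>

definition level_line :: "real \<times> real \<Rightarrow> (nat \<Rightarrow> real) \<Rightarrow> nat \<Rightarrow> (real \<times> real) set" where
  "level_line n c i = {x. n \<bullet> x = c i}"

definition leveled_planar_drawing ::
    "'a pair_pre_digraph \<Rightarrow> ('a \<Rightarrow> real \<times> real) \<Rightarrow> real \<times> real \<Rightarrow> (nat \<Rightarrow> real) \<Rightarrow> ('a \<Rightarrow> nat) \<Rightarrow> bool" where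
  "leveled_planar_drawing G p n c l \<longleftrightarrow>
     crossing_free_drawing G p \<and>
     n \<noteq> 0 \<and> strict_mono c \<and>
     (\<forall>v \<in> pverts G. p v \<in> level_line n c (l v)) \<and>
     (\<forall>(u, v) \<in> parcs G. l v = Suc (l u) \<or> l u = Suc (l v))"

definition leveled_planar :: "'a pair_pre_digraph \<Rightarrow> bool" where
  "leveled_planar G \<longleftrightarrow> (\<exists>p n c l. leveled_planar_drawing G p n c l)"

definition precedes_in :: "'a list \<Rightarrow> 'a \<Rightarrow> 'a \<Rightarrow> bool" where
  "precedes_in xs u v \<longleftrightarrow> (\<exists>i j. i < j \<and> j < length xs \<and> xs ! i = u \<and> xs ! j = v)"

text \<open>
  The tracks are the elements of the list \<open>ts\<close>; the first two conditions say that they partition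
  the vertex set into (possibly empty) sequences.
\<close>

definition track_layout :: "'a pair_pre_digraph \<Rightarrow> 'a list list \<Rightarrow> bool" where
  "track_layout G ts \<longleftrightarrow>
     distinct (concat ts) \<and> set (concat ts) = pverts G \<and>
     (\<forall>t \<in> set ts. \<forall>u \<in> set t. \<forall>v \<in> set t. (u, v) \<notin> parcs G) \<and>
     (\<forall>i < length ts. \<forall>j < length ts. i \<noteq> j \<longrightarrow>
        \<not> (\<exists>u v u' v'. (u, v) \<in> parcs G \<and> (u', v') \<in> parcs G \<and>
             precedes_in (ts ! i) u u' \<and> precedes_in (ts ! j) v' v))"

definition has_track_layout :: "nat \<Rightarrow> 'a pair_pre_digraph \<Rightarrow> bool" where
  "has_track_layout k G \<longleftrightarrow> (\<exists>ts. length ts = k \<and> track_layout G ts)"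

end

theory Submission
  imports Defs
begin

text \<open>
  The geometry is first removed: a straight-line drawing with consecutive levels is crossing-free
  exactly if the vertices of each level are linearly ordered so that no two edges between the same
  two levels cross (\<open>leveled_order\<close>).

  From levels to tracks, wrap the levels around a triangular prism: track \<open>i\<close> consists of the levels
  congruent to \<open>i\<close> modulo 3, one after the other. Two edges between the same two tracks either join
  the same two levels, or one of them lies above the other at both ends, so they do not cross.
  Bipartiteness comes from the parity of the levels.

  From tracks to levels, unroll the prism (\<open>lift\<close>): put a copy of each vertex on every integer level
  that is congruent to its track modulo 3, and lift each edge to edges between consecutive levels. A
  level function is a choice of one copy per vertex that is compatible with all edges, so it exists
  if and only if every closed walk of the graph lifts to a closed walk. Suppose that some closed
  walk rises instead, by \<open>H > 0\<close>. Repeat it forever in both directions, and let \<open>x\<close> be a copy on it of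
  the first vertex that it visits on some track, in the order of this track. The walk going up from
  \<open>x\<close>, and the walk shifted up by 3 levels and going down from the copy of \<open>x\<close> there, start at the
  left border of what they visit, the upper one going down and the lower one going up. Hence they meet (\<open>walks_meet\<close>). A common
  vertex yields a closed walk in the graph that rises by 3; each edge changes the level by 1, so this
  walk has odd length, contradicting bipartiteness (\<open>lift_closed_walk_not_rising\<close>).
  On the levels so obtained, the track orders give a leveled order, because vertices on a common
  level share their track.
\<close>

section \<open>Leveled drawings as orders on levels\<close>

text \<open>
  The position \<open>q\<close> along a level is a real number, so that it can serve directly as a coordinate.
  The last clause allows \<open>q v = q v'\<close>, which by the second clause means a common endpoint.
\<close>

definition leveled_order :: "'a pair_pre_digraph \<Rightarrow> ('a \<Rightarrow> nat) \<Rightarrow> ('a \<Rightarrow> real) \<Rightarrow> bool" where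
  "leveled_order G l q \<longleftrightarrow>
     (\<forall>(u, v) \<in> parcs G. l v = Suc (l u) \<or> l u = Suc (l v)) \<and>
     (\<forall>u \<in> pverts G. \<forall>v \<in> pverts G. l u = l v \<longrightarrow> q u = q v \<longrightarrow> u = v) \<and>
     (\<forall>(u, v) \<in> parcs G. \<forall>(u', v') \<in> parcs G.
        l u = l u' \<longrightarrow> l v = l v' \<longrightarrow> q u < q u' \<longrightarrow> q v \<le> q v')"

lemma eq_if_inner_eq_perp_eq:
  fixes n x y :: "real \<times> real"
  assumes "n \<noteq> 0" "n \<bullet> x = n \<bullet> y" "(- snd n, fst n) \<bullet> x = (- snd n, fst n) \<bullet> y"
  shows "x = y"
proof -
  obtain a b where n: "n = (a, b)" by (cases n)
  obtain x1 x2 where x: "x = (x1, x2)" by (cases x)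
  obtain y1 y2 where y: "y = (y1, y2)" by (cases y)
  define d1 d2 where "d1 = x1 - y1" and "d2 = x2 - y2"
  have 1: "a * d1 + b * d2 = 0" and 2: "a * d2 - b * d1 = 0"
    using assms(2,3) by (simp_all add: n x y d1_def d2_def algebra_simps)
  have "(a\<^sup>2 + b\<^sup>2) * d1 = a * (a * d1 + b * d2) - b * (a * d2 - b * d1)"
    and "(a\<^sup>2 + b\<^sup>2) * d2 = b * (a * d1 + b * d2) + a * (a * d2 - b * d1)"
    by algebra+
  moreover have "a\<^sup>2 + b\<^sup>2 \<noteq> 0"
    using assms(1) by (simp add: n sum_power2_eq_zero_iff zero_prod_def)
  ultimately have "d1 = 0" "d2 = 0"
    unfolding 1 2 by (metis add_0 diff_zero mult_eq_0_iff mult_zero_right)+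
  then show ?thesis
    by (simp add: x y d1_def d2_def)
qed

text \<open>
  Order each level by the coordinate along the lines. If two edges between the same two levels swap
  this order, then their points at equal height coincide somewhere by linear interpolation. That is
  a crossing, as the four endpoints are distinct.
\<close>

lemma leveled_order_if_leveled_planar_drawing:
  assumes G: "pair_graph G" and D: "leveled_planar_drawing G p n c l"
  shows "leveled_order G l (\<lambda>v. (- snd n, fst n) \<bullet> p v)"
proof -
  interpret pair_graph G by (fact G)
  let ?m = "(- snd n, fst n)"
  have n: "n \<noteq> 0" and inj: "inj_on p (pverts G)"
    and lev: "\<And>v. v \<in> pverts G \<Longrightarrow> n \<bullet> p v = c (l v)"
    and step: "\<And>u v. (u, v) \<in> parcs G \<Longrightarrow> l v = Suc (l u) \<or> l u = Suc (l v)"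
    and cross: "\<And>u v x y. (u, v) \<in> parcs G \<Longrightarrow> (x, y) \<in> parcs G \<Longrightarrow> {u, v} \<noteq> {x, y} \<Longrightarrow>
        closed_segment (p u) (p v) \<inter> closed_segment (p x) (p y) \<subseteq> p ` ({u, v} \<inter> {x, y})"
    using D unfolding leveled_planar_drawing_def crossing_free_drawing_def level_line_def by blast+
  have "?m \<bullet> p v \<le> ?m \<bullet> p v'"
    if uv: "(u, v) \<in> parcs G" and uv': "(u', v') \<in> parcs G"
      and l: "l u = l u'" "l v = l v'" and less: "?m \<bullet> p u < ?m \<bullet> p u'" for u v u' v'
  proof (rule ccontr)
    assume "\<not> ?thesis"
    then have swap: "?m \<bullet> p v' < ?m \<bullet> p v" by simp
    define d where "d = ?m \<bullet> p u' - ?m \<bullet> p u"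
    define e where "e = ?m \<bullet> p v - ?m \<bullet> p v'"
    have d: "d > 0" and e: "e > 0"
      using less swap by (simp_all add: d_def e_def)
    \<comment> \<open>The parameter at which the difference of the two edges, affine along the slab, vanishes.\<close>
    define t where "t = d / (d + e)"
    have t: "0 \<le> t" "t \<le> 1" and dt: "(1 - t) * d = t * e"
      using d e by (simp_all add: t_def field_simps)
    define z where "z = (1 - t) *\<^sub>R p u + t *\<^sub>R p v"
    define z' where "z' = (1 - t) *\<^sub>R p u' + t *\<^sub>R p v'"
    have verts: "u \<in> pverts G" "v \<in> pverts G" "u' \<in> pverts G" "v' \<in> pverts G"
      using uv uv' by (auto dest: in_arcsD1 in_arcsD2)
    have "n \<bullet> z = n \<bullet> z'"
      unfolding z_def z'_def by (simp only: inner_add_right inner_scaleR_right lev verts l)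
    moreover have "?m \<bullet> z = ?m \<bullet> z'"
      using dt unfolding z_def z'_def inner_add_right inner_scaleR_right d_def e_def
      by (simp only: algebra_simps)
    ultimately have "z = z'"
      using n by (rule eq_if_inner_eq_perp_eq[rotated])
    then have "z \<in> closed_segment (p u) (p v) \<inter> closed_segment (p u') (p v')"
      using t unfolding closed_segment_def z_def z'_def by blast
    moreover have "l u \<noteq> l v" using step[OF uv] by linarith
    then have "{u, v} \<inter> {u', v'} = {}" using less swap l by fastforce
    ultimately show False
      using cross[OF uv uv'] by fastforce
  qed
  moreover have "u = v" if "u \<in> pverts G" "v \<in> pverts G" "l u = l v" "?m \<bullet> p u = ?m \<bullet> p v" for u v
    using that inj lev eq_if_inner_eq_perp_eq[OF n] by (metis inj_onD)
  ultimately show ?thesis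
    using step unfolding leveled_order_def by blast
qed

text \<open>
  Use level and position as coordinates. Between its two levels an edge meets no vertex, and edges in
  different slabs can only meet at a vertex of a common level. In one slab, the signed
  distance of two edges along the lines is interpolated between two numbers, not both 0, that do not
  have opposite signs. So it vanishes only at an end.
\<close>

lemma leveled_planar_if_leveled_order:
  assumes G: "pair_graph G" and ord: "leveled_order G l q"
  shows "leveled_planar G"
proof -
  interpret pair_graph G by (fact G)
  define p where "p v = (real (l v), q v)" for v
  have step: "\<And>u v. (u, v) \<in> parcs G \<Longrightarrow> l v = Suc (l u) \<or> l u = Suc (l v)"
    and eqI: "\<And>u v. u \<in> pverts G \<Longrightarrow> v \<in> pverts G \<Longrightarrow> l u = l v \<Longrightarrow> q u = q v \<Longrightarrow> u = v"
    and mono: "\<And>u v u' v'. (u, v) \<in> parcs G \<Longrightarrow> (u', v') \<in> parcs G \<Longrightarrow>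
        l u = l u' \<Longrightarrow> l v = l v' \<Longrightarrow> q u < q u' \<Longrightarrow> q v \<le> q v'"
    using ord unfolding leveled_order_def by blast+
  have inj: "inj_on p (pverts G)"
    by (rule inj_onI) (auto simp: p_def intro: eqI)
  have verts: "u \<in> pverts G" "v \<in> pverts G" if "(u, v) \<in> parcs G" for u v
    using that by (auto dest: in_arcsD1 in_arcsD2)
  have sym: "(v, u) \<in> parcs G" if "(u, v) \<in> parcs G" for u v
    using that arcs_symmetric by blast
  have segE: "\<exists>s. 0 \<le> s \<and> s \<le> 1 \<and> z = (real (l u) + s, (1 - s) * q u + s * q v)"
    if z: "z \<in> closed_segment (p u) (p v)" and up: "l v = Suc (l u)" for z u v
  proof -
    obtain s where "0 \<le> s" "s \<le> 1" "z = (1 - s) *\<^sub>R p u + s *\<^sub>R p v"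
      using z unfolding in_segment by blast
    then show ?thesis
      using up by (intro exI[of _ s]) (simp add: p_def algebra_simps)
  qed
  have vert_up: "w = u \<or> w = v"
    if uv: "(u, v) \<in> parcs G" and up: "l v = Suc (l u)" and w: "w \<in> pverts G"
      and z: "p w \<in> closed_segment (p u) (p v)" for u v w
  proof -
    obtain s where s: "0 \<le> s" "s \<le> 1" "p w = (real (l u) + s, (1 - s) * q u + s * q v)"
      using segE[OF z up] by blast
    then have "real (l w) = real (l u) + s" by (simp add: p_def)
    then have "l u \<le> l w" "l w \<le> Suc (l u)" "s = real (l w) - real (l u)" using s(1,2) by linarith+
    then have "l w = l u \<and> s = 0 \<or> l w = l v \<and> s = 1" using up by (auto simp: le_Suc_eq)
    then have "p w = p u \<or> p w = p v" using s(3) up by (auto simp: p_def)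
    then show ?thesis using inj w verts[OF uv] by (meson inj_onD)
  qed
  \<comment> \<open>The last hypothesis names the ways in which two upward edges can differ, up to exchanging them:
    different slabs, the same slab with distinct lower endpoints, or a common lower endpoint.\<close>
  have edge_up: "z \<in> p ` ({u, v} \<inter> {x, y})"
    if uv: "(u, v) \<in> parcs G" "l v = Suc (l u)" and xy: "(x, y) \<in> parcs G" "l y = Suc (l x)"
      and zu: "z \<in> closed_segment (p u) (p v)" and zx: "z \<in> closed_segment (p x) (p y)"
      and le: "l u < l x \<or> l u = l x \<and> q u < q x \<or> u = x \<and> v \<noteq> y"
    for u v x y z
  proof -
    obtain s where s: "0 \<le> s" "s \<le> 1" "z = (real (l u) + s, (1 - s) * q u + s * q v)"
      using segE[OF zu uv(2)] by blast
    obtain t where t: "0 \<le> t" "t \<le> 1" "z = (real (l x) + t, (1 - t) * q x + t * q y)"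
      using segE[OF zx xy(2)] by blast
    have st: "real (l u) + s = real (l x) + t"
      and eq: "(1 - s) * q u + s * q v = (1 - t) * q x + t * q y"
      using s(3) t(3) by simp_all
    note V = verts[OF uv(1)] verts[OF xy(1)]
    from le consider "l u < l x" | "l u = l x" "q u < q x" | "u = x" "v \<noteq> y" by blast
    then show ?thesis
    proof cases
      case 1
      then have "l x = Suc (l u)" "s = 1" "t = 0" using st s(1,2) t(1,2) by linarith+
      moreover from this have "v = x" using eq uv(2) by (intro eqI V) auto
      moreover from calculation have "z = p v" using s(3) uv(2) by (simp add: p_def)
      ultimately show ?thesis by simp
    next
      case 2
      have [simp]: "t = s" using st 2 by simp
      have "q v \<le> q y" using mono[OF uv(1) xy(1)] 2 uv(2) xy(2) by simp
      have "(1 - s) * (q x - q u) + s * (q y - q v) = 0"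
        using eq by (simp add: algebra_simps)
      moreover have "(1 - s) * (q x - q u) \<ge> 0" "s * (q y - q v) \<ge> 0"
        using s 2 \<open>q v \<le> q y\<close> by simp_all
      ultimately have "(1 - s) * (q x - q u) = 0" "s * (q y - q v) = 0" by linarith+
      then have "s = 1" "q v = q y" using 2 by auto
      moreover from this have "v = y" using 2 uv(2) xy(2) by (intro eqI V) auto
      moreover from calculation have "z = p v" using s(3) uv(2) by (simp add: p_def)
      ultimately show ?thesis by simp
    next
      case 3
      have [simp]: "t = s" using st 3 by simp
      have "q v \<noteq> q y" using eqI[OF V(2,4)] 3 uv(2) xy(2) by auto
      then have "s = 0" using eq 3 by simp
      then have "z = p u" using s(3) by (simp add: p_def)
      then show ?thesis using 3 by simp
    qed
  qed
  have edge_up': "z \<in> p ` ({u, v} \<inter> {x, y})"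
    if uv: "(u, v) \<in> parcs G" "l v = Suc (l u)" and xy: "(x, y) \<in> parcs G" "l y = Suc (l x)"
      and z: "z \<in> closed_segment (p u) (p v)" "z \<in> closed_segment (p x) (p y)"
      and ne: "{u, v} \<noteq> {x, y}"
    for u v x y z
  proof -
    have "q u \<noteq> q x" if "l u = l x" "u \<noteq> x"
      using that eqI verts[OF uv(1)] verts[OF xy(1)] by blast
    then have "(l u < l x \<or> l u = l x \<and> q u < q x \<or> u = x \<and> v \<noteq> y) \<or>
        (l x < l u \<or> l x = l u \<and> q x < q u \<or> x = u \<and> y \<noteq> v)"
      using ne by (metis linorder_neqE)
    then show ?thesis
      using edge_up[OF uv xy z] edge_up[OF xy uv z(2,1)] by (metis Int_commute)
  qed
  have vert: "p w \<notin> closed_segment (p u) (p v)"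
    if "(u, v) \<in> parcs G" "w \<in> pverts G - {u, v}" for u v w
    using step[OF that(1)]
  proof
    assume "l v = Suc (l u)"
    then show ?thesis using vert_up that by blast
  next
    assume "l u = Suc (l v)"
    then show ?thesis
      using vert_up[OF sym[OF that(1)]] that closed_segment_commute[of "p u"] by blast
  qed
  have edge: "closed_segment (p u) (p v) \<inter> closed_segment (p x) (p y) \<subseteq> p ` ({u, v} \<inter> {x, y})"
    if uv: "(u, v) \<in> parcs G" and xy: "(x, y) \<in> parcs G" and ne: "{u, v} \<noteq> {x, y}" for u v x y
  proof
    fix z assume z: "z \<in> closed_segment (p u) (p v) \<inter> closed_segment (p x) (p y)"
    obtain u' v' where 1: "(u', v') \<in> parcs G" "l v' = Suc (l u')" "{u', v'} = {u, v}"
        "closed_segment (p u') (p v') = closed_segment (p u) (p v)"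
      using step[OF uv] uv sym[OF uv] by (metis closed_segment_commute insert_commute)
    obtain x' y' where 2: "(x', y') \<in> parcs G" "l y' = Suc (l x')" "{x', y'} = {x, y}"
        "closed_segment (p x') (p y') = closed_segment (p x) (p y)"
      using step[OF xy] xy sym[OF xy] by (metis closed_segment_commute insert_commute)
    show "z \<in> p ` ({u, v} \<inter> {x, y})"
      using edge_up'[OF 1(1,2) 2(1,2), of z] z ne 1(3,4) 2(3,4) by simp
  qed
  have "crossing_free_drawing G p"
    unfolding crossing_free_drawing_def using inj vert edge by blast
  moreover have "p v \<in> level_line (1, 0) real (l v)" for v
    by (simp add: level_line_def p_def)
  moreover have "strict_mono real" "(1, 0) \<noteq> (0 :: real \<times> real)"
    by (simp_all add: strict_mono_def zero_prod_def)
  ultimately have "leveled_planar_drawing G p (1, 0) real l"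
    unfolding leveled_planar_drawing_def using step by blast
  then show ?thesis unfolding leveled_planar_def by blast
qed

section \<open>From levels to three tracks\<close>

lemma precedes_in_sort_keyD:
  fixes f :: "'a \<Rightarrow> real"
  assumes "precedes_in (sort_key f xs) u v" "distinct xs"
  shows "u \<in> set xs" "v \<in> set xs" "u \<noteq> v" "f u \<le> f v"
proof -
  obtain i j where ij: "i < j" "j < length (sort_key f xs)"
      "sort_key f xs ! i = u" "sort_key f xs ! j = v"
    using assms(1) unfolding precedes_in_def by blast
  then show "u \<in> set xs" "v \<in> set xs"
    by (metis nth_mem order.strict_trans set_sort)+
  show "u \<noteq> v"
    using ij assms(2) by (auto simp: nth_eq_iff_index_eq)
  have "sorted (map f (sort_key f xs))" by simp
  then have "map f (sort_key f xs) ! i \<le> map f (sort_key f xs) ! j"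
    using ij by (intro sorted_nth_mono) simp_all
  then show "f u \<le> f v" using ij by simp
qed

lemma same_direction_mod_3:
  fixes a b a' b' :: nat
  assumes m: "a mod 3 = a' mod 3" "b mod 3 = b' mod 3" 
    and "b = Suc a \<or> a = Suc b" "b' = Suc a' \<or> a' = Suc b'"
  shows "b = Suc a \<longleftrightarrow> b' = Suc a'"
proof -
  have "\<not> (b = Suc a \<and> a' = Suc b')"
    if "a mod 3 = a' mod 3" "b mod 3 = b' mod 3" for a b a' b' :: nat
    using that by (cases "a mod 3 = 2"; cases "b' mod 3 = 2") (auto simp: mod_Suc)
  from this[OF m] this[OF m[symmetric]] show ?thesis using assms(3,4) by linarith
qed

text \<open>
  The wrapping: edges joining the same two tracks step in the same direction
  (\<open>same_direction_mod_3\<close>). So if two of them swapped their order, each level inequality at one end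
  would reverse at the other; both edges would join the same two levels and cross there.
\<close>

lemma has_track_layout_3_if_leveled_order:
  assumes G: "pair_graph G" and ord: "leveled_order G l q"
  shows "has_track_layout 3 G"
proof -
  interpret pair_graph G by (fact G)
  have step: "\<And>u v. (u, v) \<in> parcs G \<Longrightarrow> l v = Suc (l u) \<or> l u = Suc (l v)"
    and eqI: "\<And>u v. u \<in> pverts G \<Longrightarrow> v \<in> pverts G \<Longrightarrow> l u = l v \<Longrightarrow> q u = q v \<Longrightarrow> u = v"
    and mono: "\<And>u v u' v'. (u, v) \<in> parcs G \<Longrightarrow> (u', v') \<in> parcs G \<Longrightarrow>
        l u = l u' \<Longrightarrow> l v = l v' \<Longrightarrow> q u < q u' \<Longrightarrow> q v \<le> q v'"
    using ord unfolding leveled_order_def by blast+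
  \<comment> \<open>The values of arctan lie in an interval of length \<open>pi < 4\<close>, so this key orders first by level and
    then by \<open>q\<close>.\<close>
  define key where "key v = 4 * real (l v) + arctan (q v)" for v
  have key_level: "l u \<le> l v" if "key u \<le> key v" for u v
  proof (rule ccontr)
    assume "\<not> ?thesis"
    then have "real (l u) \<ge> real (l v) + 1" by simp
    then show False
      using that arctan_bounded[of "q u"] arctan_bounded[of "q v"] pi_less_4
      unfolding key_def by linarith
  qed
  obtain xs where xs: "set xs = pverts G" "distinct xs"
    using finite_distinct_list finite_verts by blast
  define track where "track i = sort_key key (filter (\<lambda>v. l v mod 3 = i) xs)" for i
  define ts where "ts = [track 0, track 1, track 2]"
  have set_track: "set (track i) = {v \<in> pverts G. l v mod 3 = i}" for i
    by (auto simp: track_def xs)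
  have nth_ts: "ts ! i = track i" if "i < 3" for i
    using that by (auto simp: ts_def less_Suc_eq numeral_3_eq_3 numeral_2_eq_2)
  have dist: "distinct (concat ts)"
    unfolding ts_def by (auto simp: set_track) (simp_all add: track_def xs)
  have "l v mod 3 = 0 \<or> l v mod 3 = 1 \<or> l v mod 3 = 2" for v by presburger
  then have cover: "set (concat ts) = pverts G"
    unfolding ts_def by (auto simp: set_track)
  have indep: "(u, v) \<notin> parcs G" if "t \<in> set ts" "u \<in> set t" "v \<in> set t" for t u v
  proof
    assume "(u, v) \<in> parcs G"
    then have "l v = Suc (l u) \<or> l u = Suc (l v)" by (rule step)
    moreover have "l u mod 3 = l v mod 3" using that by (auto simp: ts_def set_track)
    ultimately show False by (auto simp: mod_Suc split: if_splits)
  qed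
  have cross: False
    if ij: "i < 3" "j < 3" and uv: "(u, v) \<in> parcs G" and uv': "(u', v') \<in> parcs G"
      and pre: "precedes_in (track i) u u'" "precedes_in (track j) v' v" for i j u v u' v'
  proof -
    note 1 = precedes_in_sort_keyD[OF pre(1)[unfolded track_def] distinct_filter[OF xs(2)]]
    note 2 = precedes_in_sort_keyD[OF pre(2)[unfolded track_def] distinct_filter[OF xs(2)]]
    have V: "u \<in> pverts G" "u' \<in> pverts G" "v \<in> pverts G" "v' \<in> pverts G"
      and m: "l u mod 3 = l u' mod 3" "l v mod 3 = l v' mod 3"
      using 1 2 xs by simp_all
    have le: "l u \<le> l u'" "l v' \<le> l v" using 1 2 key_level by blast+
    have "l v = Suc (l u) \<longleftrightarrow> l v' = Suc (l u')"
      using same_direction_mod_3[OF m step[OF uv] step[OF uv']] .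
    then have l: "l u = l u'" "l v = l v'" using le step[OF uv] step[OF uv'] by linarith+
    then have "q u \<le> q u'" "q v' \<le> q v"
      using 1(4) 2(4) by (simp_all add: key_def arctan_le_iff)
    then have "q u < q u'" "q v' < q v"
      using eqI V l 1(3) 2(3) by (metis order_le_less)+
    then show False using mono[OF uv uv' l] by simp
  qed
  have "track_layout G ts"
    unfolding track_layout_def using dist cover indep cross nth_ts
    by (auto simp: ts_def numeral_3_eq_3[symmetric])
  then show ?thesis
    unfolding has_track_layout_def by (intro exI[of _ ts]) (simp add: ts_def)
qed

section \<open>Crossing walks\<close>

text \<open>
  A discrete intermediate value theorem. The walk \<open>P\<close> starts at the left border and rises above all of
  \<open>Q\<close>; the walk \<open>Q\<close> starts at the left border above the start of \<open>P\<close> and falls below all of \<open>P\<close>. Since \<open>P\<close>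
  may wander up and down, the side of \<open>P\<close> on which a vertex \<open>x\<close> of \<open>Q\<close> lies is measured by the parity of
  the number \<open>U x\<close> of edges of \<open>P\<close> that pass to the left of \<open>x\<close> in the slab above it; \<open>D x\<close> is the analogous
  number for the slab below. As long as the walks do not meet, two facts hold.

  An edge of \<open>Q\<close> from \<open>x\<close> up to \<open>y\<close> has the same edges of \<open>P\<close> on its left at both ends, so \<open>U x = D y\<close>.

  Every visit of \<open>P\<close> to the left of \<open>x\<close> uses two edges unless it is an end of \<open>P\<close>, so \<open>U x\<close> and \<open>D x\<close> have
  the same parity unless \<open>x\<close> is on the level where \<open>P\<close> starts.

  Hence along \<open>Q\<close> the parity of \<open>U\<close> changes exactly when \<open>Q\<close> passes below the start of \<open>P\<close>. But \<open>U\<close> is 0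
  at both ends of \<open>Q\<close>, at the first because nothing is to its left and at the last because \<open>P\<close> is above.
\<close>

lemma walks_meet:
  fixes L :: "'b \<Rightarrow> int" and q :: "'b \<Rightarrow> real"
  assumes sym: "sym A"
    and step: "\<And>x y. (x, y) \<in> A \<Longrightarrow> L y = L x + 1 \<or> L y = L x - 1"
    and mono: "\<And>x y x' y'. (x, y) \<in> A \<Longrightarrow> (x', y') \<in> A \<Longrightarrow>
        L x = L x' \<Longrightarrow> L y = L y' \<Longrightarrow> q x < q x' \<Longrightarrow> q y \<le> q y'"
    and P: "\<And>i. i < N \<Longrightarrow> (P i, P (Suc i)) \<in> A"
    and Q: "\<And>j. j < M \<Longrightarrow> (Q j, Q (Suc j)) \<in> A"
    and start: "L (P 0) < L (Q 0)"
    and left_P: "\<And>j. j \<le> M \<Longrightarrow> L (Q j) = L (P 0) \<Longrightarrow> q (P 0) \<le> q (Q j)"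
    and left_Q: "\<And>i. i \<le> N \<Longrightarrow> L (P i) = L (Q 0) \<Longrightarrow> q (Q 0) \<le> q (P i)"
    and high: "\<And>j. j \<le> M \<Longrightarrow> L (Q j) < L (P N)"
    and low: "\<And>i. i \<le> N \<Longrightarrow> L (Q M) < L (P i)"
  shows "\<exists>i \<le> N. \<exists>j \<le> M. L (P i) = L (Q j) \<and> q (P i) = q (Q j)"
proof (rule ccontr)
  assume "\<not> ?thesis"
  then have apart: "q (P i) \<noteq> q (Q j)" if "L (P i) = L (Q j)" "i \<le> N" "j \<le> M" for i j
    using that by blast
  define visit where "visit x i = (L (P i) = L x \<and> q (P i) < q x)" for x i
  define U where "U x = (\<Sum>i<N. of_bool (visit x i \<and> L (P (Suc i)) = L x + 1)
      + of_bool (visit x (Suc i) \<and> L (P i) = L x + 1) :: int)" for x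
  define D where "D x = (\<Sum>i<N. of_bool (visit x i \<and> L (P (Suc i)) = L x - 1)
      + of_bool (visit x (Suc i) \<and> L (P i) = L x - 1) :: int)" for x
  \<comment> \<open>Each edge of \<open>P\<close> leaves the level of \<open>x\<close> on exactly one side, so the sum counts pairs of a visit and
    an edge at it.\<close>
  have UD: "U x + D x = 2 * (\<Sum>i<N. of_bool (visit x i)) + of_bool (visit x N) - of_bool (visit x 0)" for x
  proof -
    have "U x + D x = (\<Sum>i<N. of_bool (visit x i) + of_bool (visit x (Suc i)))"
      unfolding U_def D_def sum.distrib[symmetric]
      by (rule sum.cong) (use P step in \<open>force simp: visit_def\<close>)+
    also have "\<dots> = (\<Sum>i<N. 2 * of_bool (visit x i) + (of_bool (visit x (Suc i)) - of_bool (visit x i)))"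
      by (rule sum.cong) simp_all
    also have "\<dots> = 2 * (\<Sum>i<N. of_bool (visit x i)) + of_bool (visit x N) - of_bool (visit x 0)"
      using sum_lessThan_telescope[of "\<lambda>i. of_bool (visit x i) :: int" N]
      by (simp only: sum.distrib sum_distrib_left)
    finally show ?thesis .
  qed
  have UD_Q: "even (U (Q j)) \<longleftrightarrow> even (D (Q j)) \<noteq> (L (Q j) = L (P 0))" if "j \<le> M" for j
  proof -
    have "\<not> visit (Q j) N" using high[OF that] by (simp add: visit_def)
    moreover have "visit (Q j) 0 \<longleftrightarrow> L (Q j) = L (P 0)"
      using left_P[OF that] apart[of 0 j] that by (force simp: visit_def)
    ultimately have "even (U (Q j) + D (Q j)) \<longleftrightarrow> L (Q j) \<noteq> L (P 0)"
      unfolding UD by simp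
    then show ?thesis by auto
  qed
  have side: "q (P i) < q (Q j) \<longleftrightarrow> q (P i') < q (Q j')"
    if "(P i, P i') \<in> A" "(Q j, Q j') \<in> A" "L (P i) = L (Q j)" "L (P i') = L (Q j')"
      "i \<le> N" "i' \<le> N" "j \<le> M" "j' \<le> M" for i i' j j'
  proof -
    have "(P i', P i) \<in> A" "(Q j', Q j) \<in> A" using that sym by (auto dest: symD)
    then show ?thesis
      using that apart mono by (metis order_le_less)
  qed
  have UD_edge: "U (Q j) = D (Q j')"
    if "(Q j, Q j') \<in> A" "L (Q j') = L (Q j) + 1" "j \<le> M" "j' \<le> M" for j j'
  proof -
    have "(visit (Q j) i \<and> L (P (Suc i)) = L (Q j) + 1) \<longleftrightarrow>
          (visit (Q j') (Suc i) \<and> L (P i) = L (Q j') - 1)"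
      "(visit (Q j) (Suc i) \<and> L (P i) = L (Q j) + 1) \<longleftrightarrow>
          (visit (Q j') i \<and> L (P (Suc i)) = L (Q j') - 1)" if "i < N" for i
      using side[OF P[OF that] \<open>(Q j, Q j') \<in> A\<close>]
        side[OF symD[OF sym P[OF that]] \<open>(Q j, Q j') \<in> A\<close>] that \<open>j \<le> M\<close> \<open>j' \<le> M\<close>
      unfolding visit_def \<open>L (Q j') = L (Q j) + 1\<close> by auto
    then show ?thesis
      unfolding U_def D_def by (intro sum.cong) (simp_all add: add.commute)
  qed
  have inv: "(even (U (Q j)) \<longleftrightarrow> L (Q j) \<ge> L (P 0))" if "j \<le> M" for j
    using that
  proof (induction j)
    case 0
    have "\<not> visit (Q 0) i" if "i \<le> N" for i
      using left_Q[OF that] by (auto simp: visit_def)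
    then have "U (Q 0) = 0" by (simp add: U_def)
    then show ?case using start by simp
  next
    case (Suc j)
    then have j: "j \<le> M" "Suc j \<le> M" and E: "(Q j, Q (Suc j)) \<in> A" using Q by simp_all
    from step[OF E] show ?case
    proof
      assume up: "L (Q (Suc j)) = L (Q j) + 1"
      show ?thesis
        using UD_edge[OF E up j] UD_Q[OF j(2)] Suc up by auto
    next
      assume "L (Q (Suc j)) = L (Q j) - 1"
      then have dn: "L (Q j) = L (Q (Suc j)) + 1" by simp
      show ?thesis
        using UD_edge[OF symD[OF sym E] dn j(2,1)] UD_Q[OF j(1)] Suc dn by auto
    qed
  qed
  have "\<not> visit (Q M) i" if "i \<le> N" for i
    using low[OF that] by (auto simp: visit_def)
  then have "U (Q M) = 0" by (simp add: U_def)
  then show False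
    using inv[of M] low[of 0] by simp
qed
section \<open>Unrolling three tracks\<close>

lemma mod_3_neighbour:
  fixes a t :: int
  assumes "0 \<le> t" "t < 3" "a mod 3 \<noteq> t"
  shows "(a + 1) mod 3 = t \<or> (a - 1) mod 3 = t"
proof -
  define r where "r = a mod 3"
  have "0 \<le> r" "r < 3" by (simp_all add: r_def)
  then have "r = 0 \<or> r = 1 \<or> r = 2" by linarith
  moreover have "t = 0 \<or> t = 1 \<or> t = 2" using assms by linarith
  moreover have "(a + 1) mod 3 = (r + 1) mod 3" "(a - 1) mod 3 = (r - 1) mod 3"
    by (simp_all add: r_def mod_add_left_eq mod_diff_left_eq)
  ultimately show ?thesis using assms(3) by (auto simp: r_def[symmetric])
qed

text \<open>
  Tracks are residues, so that unrolling is expressed by congruence. The colouring \<open>col\<close> is the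
  bipartition.
\<close>

locale bipartite_three_tracks =
  fixes V :: "'a set" and E :: "('a \<times> 'a) set"
    and tr :: "'a \<Rightarrow> int" and pos :: "'a \<Rightarrow> real" and col :: "'a \<Rightarrow> bool"
  assumes E_V: "E \<subseteq> V \<times> V"
    and sym_E: "sym E"
    and col: "(u, v) \<in> E \<Longrightarrow> col u \<noteq> col v"
    and tr_range: "v \<in> V \<Longrightarrow> tr v \<in> {0..<3}"
    and tr_neq: "(u, v) \<in> E \<Longrightarrow> tr u \<noteq> tr v"
    and pos_inj: "u \<in> V \<Longrightarrow> v \<in> V \<Longrightarrow> tr u = tr v \<Longrightarrow> pos u = pos v \<Longrightarrow> u = v"
    and noncrossing: "(u, v) \<in> E \<Longrightarrow> (u', v') \<in> E \<Longrightarrow> tr u = tr u' \<Longrightarrow> tr v = tr v' \<Longrightarrow>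
      pos u < pos u' \<Longrightarrow> pos v \<le> pos v'"
begin

text \<open>The edges of the unrolled graph, which is invariant under shifts by multiples of 3 levels.\<close>

definition lift :: "(('a \<times> int) \<times> ('a \<times> int)) set" where
  "lift = {((u, a), (v, b)). (u, v) \<in> E \<and> a mod 3 = tr u \<and> b mod 3 = tr v \<and> (b = a + 1 \<or> b = a - 1)}"

lemma lift_iff:
  "(x, y) \<in> lift \<longleftrightarrow> (fst x, fst y) \<in> E \<and> snd x mod 3 = tr (fst x) \<and> snd y mod 3 = tr (fst y) \<and>
     (snd y = snd x + 1 \<or> snd y = snd x - 1)"
  by (cases x; cases y) (simp add: lift_def)

lemma sym_lift: "sym lift"
  using sym_E by (intro symI) (auto simp: lift_iff dest: symD)

lemma lift_shift:
  assumes "(x, y) \<in> lift" "3 dvd k"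
  shows "((fst x, snd x + k), (fst y, snd y + k)) \<in> lift"
  using assms by (auto simp: lift_iff elim!: dvdE)

lemma lift_ex:
  assumes "(u, v) \<in> E" "a mod 3 = tr u"
  shows "\<exists>b. ((u, a), (v, b)) \<in> lift"
proof -
  have "(a + 1) mod 3 = tr v \<or> (a - 1) mod 3 = tr v"
    using tr_range[of v] tr_neq[OF assms(1)] assms E_V by (intro mod_3_neighbour) auto
  then show ?thesis using assms by (auto simp: lift_iff)
qed

lemma lift_rtrancl_level:
  assumes "(x, y) \<in> lift\<^sup>*" "snd x mod 3 = tr (fst x)"
  shows "snd y mod 3 = tr (fst y)"
  using assms by induction (auto simp: lift_iff)

text \<open>
  A walk that ends above or below its start is repeated with the accumulated shift. The shift is a
  multiple of 3 because both ends are copies of one vertex, so the repetitions are walks as well.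
\<close>

lemma periodic_lift_walk:
  assumes "((v, a), (v, b)) \<in> lift\<^sup>*" "a \<noteq> b"
  obtains n :: nat and g :: "int \<Rightarrow> 'a \<times> int" where
    "n > 0" "\<And>i. (g i, g (i + 1)) \<in> lift"
    "\<And>i k. g (i + int n * k) = (fst (g i), snd (g i) + (b - a) * k)"
proof -
  obtain n f where f: "f 0 = (v, a)" "f n = (v, b)" and step: "\<And>i. i < n \<Longrightarrow> (f i, f (Suc i)) \<in> lift"
    using assms(1) unfolding rtrancl_power relpow_fun_conv by blast
  have n: "n > 0" using f assms(2) by (cases n) auto
  have "(f 0, f 1) \<in> lift" "(f (n - 1), f n) \<in> lift"
    using step[of 0] step[of "n - 1"] n by simp_all
  then have "a mod 3 = b mod 3" unfolding lift_iff f by simp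
  then have H: "3 dvd (b - a) * k" for k
    by (metis dvd_mult2 mod_eq_dvd_iff)
  define g where "g i = (fst (f (nat (i mod int n))), snd (f (nat (i mod int n))) + (b - a) * (i div int n))" for i
  have "(g i, g (i + 1)) \<in> lift" for i
  proof -
    define r where "r = nat (i mod int n)"
    define k where "k = i div int n"
    have r: "int r = i mod int n" "r < n" using n by (simp_all add: r_def nat_less_iff)
    have i: "i = int n * k + int r" using r by (simp add: k_def)
    have gi: "g i = (fst (f r), snd (f r) + (b - a) * k)"
      by (simp add: g_def r_def k_def)
    have "g (i + 1) = (fst (f (Suc r)), snd (f (Suc r)) + (b - a) * k)"
    proof (cases "Suc r = n")
      case True
      have "i + 1 = int n * (k + 1) + 0" using i True by (simp add: algebra_simps)
      then have "(i + 1) mod int n = 0" "(i + 1) div int n = k + 1"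
        using n int_mod_pos_eq[of "i + 1" "int n" "k + 1" 0] int_div_pos_eq[of "i + 1" "int n" "k + 1" 0]
        by simp_all
      then show ?thesis using f by (simp add: g_def True algebra_simps)
    next
      case False
      have "i + 1 = int n * k + int (Suc r)" using i by simp
      then have "(i + 1) mod int n = int (Suc r)" "(i + 1) div int n = k"
        using n False r int_mod_pos_eq[of "i + 1" "int n" k "int (Suc r)"]
          int_div_pos_eq[of "i + 1" "int n" k "int (Suc r)"]
        by simp_all
      then show ?thesis by (simp only: g_def nat_int)
    qed
    then show ?thesis using lift_shift[OF step[OF r(2)] H[of k]] gi by simp
  qed
  moreover have "g (i + int n * k) = (fst (g i), snd (g i) + (b - a) * k)" for i k
    using n by (simp add: g_def algebra_simps)
  ultimately show thesis using n that by blast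
qed

text \<open>
  The topological heart of the argument. By \<open>walks_meet\<close>, the periodic walk meets its own
  copy three levels higher: a translate of a rising periodic walk cannot stay on one side of it. A
  shift by 3 is the least one that preserves tracks, and it is odd.
\<close>

lemma lift_closed_walk_not_rising:
  assumes walk: "((v, a), (v, b)) \<in> lift\<^sup>*"
  shows "\<not> a < b"
proof
  assume "a < b"
  then have "a \<noteq> b" by simp
  obtain n g where n: "n > 0"
    and step: "\<And>i. (g i, g (i + 1)) \<in> lift"
    and per: "\<And>i k. g (i + int n * k) = (fst (g i), snd (g i) + (b - a) * k)"
    by (rule periodic_lift_walk[OF walk \<open>a \<noteq> b\<close>]) (rule that)
  define H where "H = b - a"
  have H: "H \<ge> 1" using \<open>a < b\<close> by (simp add: H_def)
  define w h where "w i = fst (g i)" and "h i = snd (g i)" for i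
  have w_per: "w (i + int n * k) = w i" and h_per: "h (i + int n * k) = h i + H * k" for i k
    by (simp_all add: w_def h_def per H_def)
  have w_V: "w i \<in> V" and h_tr: "h i mod 3 = tr (w i)" for i
    using step[of i] E_V by (auto simp: lift_iff w_def h_def)
  have h_step: "\<bar>h (i + int k) - h i\<bar> \<le> int k" for i k
  proof (induction k)
    case (Suc k)
    have "h (i + int (Suc k)) = h (i + int k) + 1 \<or> h (i + int (Suc k)) = h (i + int k) - 1"
      using step[of "i + int k"] by (auto simp: lift_iff h_def ac_simps)
    then show ?case using Suc by auto
  qed simp
  \<comment> \<open>Each step changes both the colour and the parity of the level.\<close>
  have parity: "(col (w (i + int k)) = even (h (i + int k))) = (col (w i) = even (h i))" for i k
  proof (induction k)
    case (Suc k)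
    have "(col (w (i + int (Suc k))) = even (h (i + int (Suc k)))) =
        (col (w (i + int k)) = even (h (i + int k)))"
      using step[of "i + int k"] col[of "w (i + int k)" "w (i + int (Suc k))"]
      by (auto simp: lift_iff h_def w_def ac_simps)
    then show ?case using Suc by simp
  qed simp
  \<comment> \<open>The leftmost visit to some track; by periodicity one period suffices to find it.\<close>
  obtain i0 where left: "\<And>i. tr (w i) = tr (w i0) \<Longrightarrow> pos (w i0) \<le> pos (w i)"
  proof -
    define I where "I = {i \<in> {0..<int n}. tr (w i) = tr (w 0)}"
    have I: "finite I" unfolding I_def by (rule finite_subset[of _ "{0..<int n}"]) auto
    have "0 \<in> I" using n by (simp add: I_def)
    then obtain i0 where i0: "i0 \<in> I" "pos (w i0) = Min ((\<lambda>i. pos (w i)) ` I)"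
      using Min_in[of "(\<lambda>i. pos (w i)) ` I"] I by fastforce
    have "pos (w i0) \<le> pos (w i)" if "tr (w i) = tr (w i0)" for i
    proof -
      have "w (i mod int n) = w i"
        using w_per[of "i mod int n" "i div int n"] by simp
      moreover from this have "i mod int n \<in> I" using that i0(1) n by (auto simp: I_def)
      ultimately show ?thesis using i0(2) I by (metis Min_le finite_imageI imageI)
    qed
    then show thesis by (rule that)
  qed
  \<comment> \<open>Within a period the level varies by at most \<open>n\<close>, and the walk rises from period to period.\<close>
  have h_later: "h (i0 + int i) \<ge> h i0 - int n" for i
  proof -
    have "h (i0 + int i) = h (i0 + int (i mod n)) + H * int (i div n)"
      using h_per[of "i0 + int (i mod n)" "int (i div n)"]
      by (simp add: of_nat_mult[symmetric] of_nat_add[symmetric] add.assoc del: of_nat_mult of_nat_add)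
    moreover have "H * int (i div n) \<ge> 0" using H by simp
    moreover have "int (i mod n) \<le> int n" using n by (simp add: less_imp_le)
    ultimately show ?thesis using h_step[of i0 "i mod n"] by linarith
  qed
  have h_earlier: "h (i0 - int i) \<le> h i0 + int n" for i
  proof -
    have "i0 - int i = (i0 - int (i mod n)) + int n * (- int (i div n))"
      by (simp add: of_nat_mult[symmetric] of_nat_add[symmetric] algebra_simps del: of_nat_mult of_nat_add)
    then have "h (i0 - int i) = h (i0 - int (i mod n)) + H * (- int (i div n))"
      using h_per by metis
    moreover have "H * int (i div n) \<ge> 0" using H by simp
    moreover have "int (i mod n) \<le> int n" using n by (simp add: less_imp_le)
    ultimately show ?thesis using h_step[of "i0 - int (i mod n)" "i mod n"] by simp
  qed
  \<comment> \<open>Each of the \<open>n + 5\<close> periods gains at least 1, which beats the variation \<open>n\<close> and the shift 3.\<close>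
  define N where "N = n * (n + 5)"
  have H_N: "H * int (n + 5) \<ge> int n + 5"
    using mult_right_mono[OF H, of "int (n + 5)"] by simp
  have hN: "h (i0 + int N) = h i0 + H * int (n + 5)" "h (i0 - int N) = h i0 - H * int (n + 5)"
    using h_per[of i0 "int (n + 5)"] h_per[of i0 "- int (n + 5)"]
    unfolding N_def of_nat_mult mult_minus_right by simp_all
  define P where "P i = g (i0 + int i)" for i
  define Q where "Q j = (w (i0 - int j), h (i0 - int j) + 3)" for j
  have P_eq: "P i = (w (i0 + int i), h (i0 + int i))" for i
    by (simp add: P_def w_def h_def)
  have "\<exists>i \<le> N. \<exists>j \<le> N. snd (P i) = snd (Q j) \<and> pos (fst (P i)) = pos (fst (Q j))"
  proof (rule walks_meet[where A = lift])
    show "sym lift" by (rule sym_lift)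
  next
    fix x y assume "(x, y) \<in> lift"
    then show "snd y = snd x + 1 \<or> snd y = snd x - 1" by (simp add: lift_iff)
  next
    fix x y x' y'
    assume "(x, y) \<in> lift" "(x', y') \<in> lift" "snd x = snd x'" "snd y = snd y'"
      and "pos (fst x) < pos (fst x')"
    then show "pos (fst y) \<le> pos (fst y')"
      using noncrossing[of "fst x" "fst y" "fst x'" "fst y'"] by (simp add: lift_iff)
  next
    fix i show "(P i, P (Suc i)) \<in> lift"
      using step[of "i0 + int i"] by (simp add: P_def ac_simps)
  next
    fix j
    have "(g (i0 - int (Suc j)), g (i0 - int j)) \<in> lift"
      using step[of "i0 - int (Suc j)"] by simp
    from lift_shift[OF symD[OF sym_lift this], of 3] show "(Q j, Q (Suc j)) \<in> lift"
      by (simp add: Q_def w_def h_def)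
  next
    show "snd (P 0) < snd (Q 0)" by (simp add: P_eq Q_def)
  next
    fix j assume "snd (Q j) = snd (P 0)"
    then have "h (i0 - int j) + 3 = h i0" by (simp add: P_eq Q_def)
    then have "tr (w (i0 - int j)) = tr (w i0)" by (metis h_tr mod_add_self2)
    then show "pos (fst (P 0)) \<le> pos (fst (Q j))" using left by (simp add: P_eq Q_def)
  next
    fix i assume "snd (P i) = snd (Q 0)"
    then have "h (i0 + int i) = h i0 + 3" by (simp add: P_eq Q_def)
    then have "tr (w (i0 + int i)) = tr (w i0)" by (metis h_tr mod_add_self2)
    then show "pos (fst (Q 0)) \<le> pos (fst (P i))" using left by (simp add: P_eq Q_def)
  next
    fix j show "snd (Q j) < snd (P N)"
      using h_earlier[of j] H_N hN(1) unfolding P_eq Q_def snd_conv by linarith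
  next
    fix i show "snd (Q N) < snd (P i)"
      using h_later[of i] H_N hN(2) unfolding P_eq Q_def snd_conv by linarith
  qed
  then obtain i j where h: "h (i0 + int i) = h (i0 - int j) + 3"
      and "pos (w (i0 + int i)) = pos (w (i0 - int j))"
    by (auto simp: P_eq Q_def)
  moreover have "tr (w (i0 + int i)) = tr (w (i0 - int j))"
    by (metis h h_tr mod_add_self2)
  ultimately have "w (i0 + int i) = w (i0 - int j)" using pos_inj w_V by blast
  then show False using parity[of "i0 - int j" "i + j"] h by auto
qed

lemma lift_closed_walk:
  assumes "((v, a), (v, b)) \<in> lift\<^sup>*"
  shows "a = b"
proof -
  have "((v, b), (v, a)) \<in> lift\<^sup>*"
    using assms sym_lift by (meson symD sym_rtrancl)
  then show ?thesis using lift_closed_walk_not_rising assms by (metis linorder_neqE)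
qed

text \<open>
  The level of a vertex is found by walking from a fixed root of its component; closed walks lift to
  closed walks, so the choice of the walk does not matter.
\<close>

lemma ex_level_function:
  obtains lam :: "'a \<Rightarrow> int" where
    "\<And>v. v \<in> V \<Longrightarrow> lam v mod 3 = tr v"
    "\<And>u v. (u, v) \<in> E \<Longrightarrow> lam v = lam u + 1 \<or> lam v = lam u - 1"
proof -
  define reach where "reach r v b \<longleftrightarrow> r \<in> V \<and> ((r, tr r), (v, b)) \<in> lift\<^sup>*" for r v b
  have reach_level: "b mod 3 = tr v" if "reach r v b" for r v b
    using lift_rtrancl_level[of "(r, tr r)" "(v, b)"] tr_range[of r] that by (simp add: reach_def)
  have reach_unique: "b = b'" if "reach r v b" "reach r v b'" for r v b b'
    using that sym_lift unfolding reach_def by (meson lift_closed_walk rtrancl_trans symD sym_rtrancl)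
  have reach_step: "\<exists>b'. reach r v b' \<and> (b' = b + 1 \<or> b' = b - 1)" if uv: "(u, v) \<in> E" and u: "reach r u b" for r u v b
  proof -
    obtain b' where "((u, b), (v, b')) \<in> lift"
      using lift_ex[OF uv reach_level[OF u]] by blast
    then have "reach r v b'" "b' = b + 1 \<or> b' = b - 1"
      using u unfolding reach_def by (auto simp: lift_iff intro: rtrancl_into_rtrancl)
    then show ?thesis by blast
  qed
  \<comment> \<open>The chosen root depends only on the set of vertices that reach \<open>v\<close>, so neighbours share it.\<close>
  define root where "root v = (SOME r. \<exists>b. reach r v b)" for v
  define lam where "lam v = (SOME b. reach (root v) v b)" for v
  have lam: "reach (root v) v (lam v)" if "v \<in> V" for v
  proof -
    have "reach v v (tr v)" using that by (simp add: reach_def)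
    then have "\<exists>b. reach (root v) v b"
      unfolding root_def by (intro someI[of "\<lambda>r. \<exists>b. reach r v b" v] exI)
    then show ?thesis unfolding lam_def by (rule someI_ex[of "reach (root v) v"])
  qed
  have "lam v = lam u + 1 \<or> lam v = lam u - 1" if uv: "(u, v) \<in> E" for u v
  proof -
    have vu: "(v, u) \<in> E" and V: "u \<in> V" "v \<in> V" using uv sym_E E_V by (auto dest: symD)
    have "(\<exists>b. reach r u b) \<longleftrightarrow> (\<exists>b. reach r v b)" for r
      using reach_step[OF uv] reach_step[OF vu] by blast
    then have root: "root u = root v" by (simp add: root_def)
    obtain b where "reach (root u) v b" "b = lam u + 1 \<or> b = lam u - 1"
      using reach_step[OF uv lam[OF V(1)]] by blast
    then show ?thesis using reach_unique lam[OF V(2)] root by metis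
  qed
  then show thesis using that lam reach_level by blast
qed

end

lemma leveled_planar_if_bipartite_three_tracks:
  assumes G: "pair_graph G" and bip: "bipartite G" and track: "has_track_layout 3 G"
  shows "leveled_planar G"
proof -
  interpret pair_graph G by (fact G)
  from bip obtain A B where disj: "A \<inter> B = {}"
      and AB: "\<forall>(u, v) \<in> parcs G. (u \<in> A \<and> v \<in> B) \<or> (u \<in> B \<and> v \<in> A)"
    unfolding bipartite_def by (elim exE conjE) (rule that)
  obtain ts where len: "length ts = 3" and layout: "track_layout G ts"
    using track unfolding has_track_layout_def by (elim exE conjE) (rule that)
  have cover: "set (concat ts) = pverts G"
    and indep: "\<And>t u v. t \<in> set ts \<Longrightarrow> u \<in> set t \<Longrightarrow> v \<in> set t \<Longrightarrow> (u, v) \<notin> parcs G"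
    using layout unfolding track_layout_def by simp_all
  have cross: False
    if "i < 3" "j < 3" "i \<noteq> j" "(u, v) \<in> parcs G" "(u', v') \<in> parcs G"
      "precedes_in (ts ! i) u u'" "precedes_in (ts ! j) v' v" for i j u v u' v'
    using layout that len unfolding track_layout_def by metis
  define tr where "tr v = (SOME i. i < 3 \<and> v \<in> set (ts ! i))" for v
  have tr: "tr v < 3" "v \<in> set (ts ! tr v)" if v: "v \<in> pverts G" for v
  proof -
    obtain t where "t \<in> set ts" "v \<in> set t" using v cover by auto
    then have "\<exists>i. i < 3 \<and> v \<in> set (ts ! i)" by (metis in_set_conv_nth len)
    from someI_ex[OF this] show "tr v < 3" "v \<in> set (ts ! tr v)" by (simp_all add: tr_def)
  qed
  define pos where "pos v = (SOME k. k < length (ts ! tr v) \<and> ts ! tr v ! k = v)" for v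
  have pos: "pos v < length (ts ! tr v)" "ts ! tr v ! pos v = v" if "v \<in> pverts G" for v
    using someI_ex[OF tr(2)[OF that, unfolded in_set_conv_nth]] by (simp_all add: pos_def)
  have precI: "precedes_in (ts ! tr u) u v"
    if "u \<in> pverts G" "v \<in> pverts G" "tr u = tr v" "pos u < pos v" for u v
    unfolding precedes_in_def using that pos by metis
  have verts: "u \<in> pverts G" "v \<in> pverts G" if "(u, v) \<in> parcs G" for u v
    using that by (auto dest: in_arcsD1 in_arcsD2)
  have tr_neq: "tr u \<noteq> tr v" if "(u, v) \<in> parcs G" for u v
  proof
    assume "tr u = tr v"
    then have "u \<in> set (ts ! tr v)" "v \<in> set (ts ! tr v)" "ts ! tr v \<in> set ts"
      using tr verts[OF that] len by (metis, metis, metis nth_mem)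
    then show False using indep that by blast
  qed
  interpret T: bipartite_three_tracks "pverts G" "parcs G" "\<lambda>v. int (tr v)" "\<lambda>v. real (pos v)" "\<lambda>v. v \<in> A"
  proof
    show "parcs G \<subseteq> pverts G \<times> pverts G" using verts by auto
    show "sym (parcs G)" using arcs_symmetric by (intro symI) blast
    show "(u \<in> A) \<noteq> (v \<in> A)" if "(u, v) \<in> parcs G" for u v
      using AB disj that by auto
    show "int (tr v) \<in> {0..<3}" if "v \<in> pverts G" for v
      using tr(1)[OF that] by simp
    show "int (tr u) \<noteq> int (tr v)" if "(u, v) \<in> parcs G" for u v
      using tr_neq[OF that] by simp
    show "u = v" if "u \<in> pverts G" "v \<in> pverts G" "int (tr u) = int (tr v)" "real (pos u) = real (pos v)" for u v
      using that pos(2) by (metis of_nat_eq_iff)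
    show "real (pos v) \<le> real (pos v')"
      if uv: "(u, v) \<in> parcs G" and uv': "(u', v') \<in> parcs G"
        and "int (tr u) = int (tr u')" "int (tr v) = int (tr v')" "real (pos u) < real (pos u')" for u v u' v'
    proof (rule ccontr)
      assume "\<not> real (pos v) \<le> real (pos v')"
      then have "precedes_in (ts ! tr u) u u'" "precedes_in (ts ! tr v') v' v"
        using that verts[OF uv] verts[OF uv'] precI[of u u'] precI[of v' v] by simp_all
      then show False
        using cross[OF _ _ _ uv uv', of "tr u" "tr v"] tr(1) verts[OF uv] tr_neq[OF uv] that(4) by simp
    qed
  qed
  obtain lam where lam: "\<And>v. v \<in> pverts G \<Longrightarrow> lam v mod 3 = int (tr v)"
      "\<And>u v. (u, v) \<in> parcs G \<Longrightarrow> lam v = lam u + 1 \<or> lam v = lam u - 1"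
    using T.ex_level_function by blast
  \<comment> \<open>Levels are natural numbers, so the integer levels are shifted above 0.\<close>
  obtain m where m: "\<And>v. v \<in> pverts G \<Longrightarrow> m \<le> lam v"
    using bdd_below_finite[OF finite_imageI[OF finite_verts, of lam]] by (auto simp: bdd_below_def)
  define l where "l v = nat (lam v - m)" for v
  have l: "lam u = lam v" if "u \<in> pverts G" "v \<in> pverts G" "l u = l v" for u v
    using m[OF that(1)] m[OF that(2)] that(3) by (simp add: l_def)
  have "leveled_order G l (\<lambda>v. real (pos v))"
    unfolding leveled_order_def
  proof (safe)
    fix u v assume uv: "(u, v) \<in> parcs G" "l u \<noteq> Suc (l v)"
    then show "l v = Suc (l u)"
      using lam(2)[OF uv(1)] m[OF verts(1)[OF uv(1)]] m[OF verts(2)[OF uv(1)]]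
      unfolding l_def by linarith
  next
    fix u v assume "u \<in> pverts G" "v \<in> pverts G" "l u = l v" "real (pos u) = real (pos v)"
    then show "u = v" using T.pos_inj l lam(1) by metis
  next
    fix u v u' v' assume "(u, v) \<in> parcs G" "(u', v') \<in> parcs G" "l u = l u'" "l v = l v'"
      and "real (pos u) < real (pos u')"
    then show "real (pos v) \<le> real (pos v')" using T.noncrossing l lam(1) verts by metis
  qed
  with G show ?thesis by (rule leveled_planar_if_leveled_order)
qed

section \<open>The characterisation\<close>

lemma bipartite_if_leveled_order:
  assumes "pair_graph G" "leveled_order G l q"
  shows "bipartite G"
proof -
  interpret pair_graph G by (fact assms(1))
  have "u \<in> pverts G" "v \<in> pverts G" "even (l u) \<noteq> even (l v)" if "(u, v) \<in> parcs G" for u v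
    using that assms(2) unfolding leveled_order_def by (auto dest: in_arcsD1 in_arcsD2)
  then show ?thesis
    unfolding bipartite_def
    by (intro exI[of _ "{v \<in> pverts G. even (l v)}"] exI[of _ "{v \<in> pverts G. odd (l v)}"]) auto
qed

theorem theorem4:
  fixes G :: "'a pair_pre_digraph"
  assumes "pair_graph G"
  shows "leveled_planar G \<longleftrightarrow> bipartite G \<and> has_track_layout 3 G"
proof
  assume "leveled_planar G"
  then obtain p n c l where "leveled_planar_drawing G p n c l"
    unfolding leveled_planar_def by blast
  from leveled_order_if_leveled_planar_drawing[OF assms this]
  show "bipartite G \<and> has_track_layout 3 G"
    using bipartite_if_leveled_order has_track_layout_3_if_leveled_order assms by blast
next
  assume "bipartite G \<and> has_track_layout 3 G"
  then show "leveled_planar G"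
    using leveled_planar_if_bipartite_three_tracks assms by blast
qed

end
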